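(* Let $n\ge 1$, let $m\ge 2$ be even, let $p$ be a divisor of $m$, let $G=G(m,p,n)$ and $\mu(G)=W_{\mathcal C,\mathcal C'}$, where $\mathcal C,\mathcal C'$ are the subgroups of $\mathbb C^\times$ of orders $m$ and $\frac mp$ respectively. Then the groups $G$ and $\mu(G)$ are not isomorphic as abstract groups if and only if $n$ is even and $\frac mp$ is odd.
   Context: $\mathbb G_n=(\mathbb C^\times)^n\rtimes\mathbb S_n\subset\mathrm{GL}_n(\mathbb C)$ is the group of monomial matrices, with $(\mathbb C^\times)^n$ the diagonal matrices and $\mathbb S_n$ the permutation matrices; each element is uniquely $tw$ with $t\in(\mathbb C^\times)^n$, $w\in\mathbb S_n$. $\det$ is the matrix determinant. For finite subgroups $\mathcal C'\subseteq\mathcal C$ of $\mathbb C^\times$ of orders $\frac mp$ and $m$, $$G(m,p,n)=\{tw\in\mathcal C^n\rtimes\mathbb S_n:\det t\in\mathcal C'\},\qquad W_{\mathcal C,\mathcal C'}=\{tw\in\mathcal C^n\rtimes\mathbb S_n:\det(tw)\in\mathcal C'\}.$$ *)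

theory Defs
  imports
    "HOL-Algebra.Group"
    "HOL-Combinatorics.Permutations"
    "Jordan_Normal_Form.Matrix"
    "Jordan_Normal_Form.Determinant"
begin

definition cmult_group :: "complex monoid" where
  "cmult_group = \<lparr>carrier = UNIV - {0}, mult = (*), one = 1\<rparr>"

definition GLn :: "nat \<Rightarrow> complex mat monoid" where
  "GLn n = units_of (ring_mat TYPE(complex) n ())"

definition diag_mats :: "nat \<Rightarrow> complex set \<Rightarrow> complex mat set" where
  "diag_mats n C = {mat_diag n f | f. \<forall>i<n. f i \<in> C}"

text \<open>The matrix of \<open>w\<close> sends the \<open>j\<close>-th basis vector to the \<open>w j\<close>-th one,
  so \<open>w \<mapsto> perm_mat n w\<close> is multiplicative.\<close>

definition perm_mat :: "nat \<Rightarrow> (nat \<Rightarrow> nat) \<Rightarrow> complex mat" where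
  "perm_mat n w = mat n n (\<lambda>(i, j). if i = w j then 1 else 0)"

definition perm_mats :: "nat \<Rightarrow> complex mat set" where
  "perm_mats n = {perm_mat n w | w. w permutes {..<n}}"

text \<open>In the next two definitions \<open>C' \<subseteq> C\<close> are meant to be finite subgroups of the
  multiplicative group of the complex numbers. If they have orders \<open>m div p\<close> and \<open>m\<close>, the
  first is \<open>G(m,p,n)\<close>, where the determinant of the diagonal part alone is constrained;
  in the second it is the determinant of the whole monomial matrix.\<close>

definition G_group :: "nat \<Rightarrow> complex set \<Rightarrow> complex set \<Rightarrow> complex mat monoid" where
  "G_group n C C' =
     (GLn n)\<lparr>carrier := {t * w | t w. t \<in> diag_mats n C \<and> w \<in> perm_mats n \<and> det t \<in> C'}\<rparr>"

definition W_group :: "nat \<Rightarrow> complex set \<Rightarrow> complex set \<Rightarrow> complex mat monoid" where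
  "W_group n C C' =
     (GLn n)\<lparr>carrier := {t * w | t w. t \<in> diag_mats n C \<and> w \<in> perm_mats n \<and> det (t * w) \<in> C'}\<rparr>"

end

theory Submission
  imports Defs "HOL-Combinatorics.Cycles"
begin

text \<open>
  If \<open>m / p\<close> is even then \<open>- 1 \<in> C'\<close> and the two groups coincide; if \<open>n\<close> is odd, scaling \<open>tw\<close> by
  \<open>det w\<close> is an isomorphism. For \<open>n\<close> even and \<open>m / p\<close> odd, let \<open>N\<close> be the largest power of \<open>2\<close>
  dividing \<open>n\<close>: then \<open>x ^ N = 1\<close> has strictly more solutions in \<open>G\<close> than in \<open>\<mu>(G)\<close>. Indeed,
  consider solutions \<open>tw\<close> lying over a fixed \<open>w\<close>; only odd \<open>w\<close> matter. If some cycle of \<open>w\<close> is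
  shorter than \<open>N\<close>, negating one entry of \<open>t\<close> on it preserves \<open>(tw) ^ N = 1\<close> and exchanges the
  solutions in \<open>G\<close> with those in \<open>\<mu>(G)\<close>. Otherwise \<open>w\<close> has \<open>n / N\<close>, an odd number, of cycles
  of length \<open>N\<close>, and \<open>(tw) ^ N = 1\<close> forces \<open>det t = 1\<close> and \<open>det w = - 1\<close>, so all solutions lie
  in \<open>G\<close>.
\<close>

subsection \<open>Permutations with cycles of equal length\<close>

lemma sign_cycle_of_list:
  assumes "cycle cs"
  shows "sign (cycle_of_list cs) = (-1) ^ (length cs - 1)"
  using assms
  by (induction cs rule: cycle_of_list.induct)
     (auto simp: sign_compose permutation_of_cycle sign_swap_id permutation_swap_id
       simp flip: id_def)

lemma funpow_cycle_of_list_nth: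
  assumes "cycle cs" "cs \<noteq> []"
  shows "(cycle_of_list cs ^^ k) (cs ! 0) = cs ! (k mod length cs)"
proof -
  have "(cycle_of_list cs ^^ k) (cs ! 0) = map (cycle_of_list cs ^^ k) cs ! 0"
    using assms by simp
  also have "\<dots> = rotate k cs ! 0"
    by (simp only: cyclic_rotation[OF assms(1)])
  also have "\<dots> = cs ! (k mod length cs)"
    using assms by (simp add: nth_rotate)
  finally show ?thesis .
qed

text \<open>Lets a product of disjoint permutations be iterated, on the support of one factor, as
  that factor alone.\<close>

lemma funpow_cong_invariant:
  assumes "x \<in> A" "f ` A \<subseteq> A" "\<And>y. y \<in> A \<Longrightarrow> g y = f y"
  shows "(g ^^ k) x = (f ^^ k) x"
proof -
  have "(g ^^ k) x = (f ^^ k) x \<and> (f ^^ k) x \<in> A"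
    using assms by (induction k) auto
  then show ?thesis ..
qed

lemma cycle_decomp_permutes:
  assumes "cycle_decomp S w"
  shows "w permutes S \<and> finite S"
  using assms
proof (induction rule: cycle_decomp.induct)
  case empty
  then show ?case by (simp add: permutes_empty id_def)
next
  case (comp I p cs)
  then show ?case
    using permutes_compose[OF permutes_subset[of p I] permutes_subset[OF cycle_permutes]] by blast
qed

text \<open>Induction over the cycles. The condition on \<open>w ^^ k\<close> makes every orbit have
  exactly \<open>N\<close> elements, so each nonempty cycle has length \<open>N\<close>, is an odd
  permutation because \<open>N\<close> is even, and has \<open>s\<close>-product 1. Thus
  \<open>c\<close> counts the nonempty cycles.\<close>

lemma cycle_decomp_uniform:
  fixes s :: "'a \<Rightarrow> 'b::comm_monoid_mult"
  assumes "cycle_decomp S w" and "even N"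
    and "\<And>x k. x \<in> S \<Longrightarrow> (w ^^ k) x = x \<longleftrightarrow> N dvd k"
    and "\<And>x. x \<in> S \<Longrightarrow> (\<Prod>i<N. s ((w ^^ i) x)) = 1"
  shows "\<exists>c. card S = N * c \<and> sign w = (-1) ^ c \<and> (\<Prod>x\<in>S. s x) = 1"
  using assms
proof (induction rule: cycle_decomp.induct)
  case empty
  show ?case by (intro exI[of _ 0]) simp
next
  case (comp I p cs)
  let ?c = "cycle_of_list cs"
  have p: "p permutes I" "finite I"
    using cycle_decomp_permutes[OF comp.hyps(1)] by auto
  have on_I: "((?c \<circ> p) ^^ k) x = (p ^^ k) x" if "x \<in> I" for x k
    using that p comp.hyps permutes_in_image[OF p(1)]
    by (intro funpow_cong_invariant[where A = I]) (auto intro!: id_outside_supp)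
  have on_cs: "((?c \<circ> p) ^^ k) x = (?c ^^ k) x" if "x \<in> set cs" for x k
    using that p comp.hyps permutes_in_image[OF cycle_permutes[of cs]]
    by (intro funpow_cong_invariant[where A = "set cs"])
       (auto simp: permutes_not_in[OF p(1)] disjoint_iff)
  have "\<exists>c. card I = N * c \<and> sign p = (-1) ^ c \<and> (\<Prod>x\<in>I. s x) = 1"
  proof (rule comp.IH[OF comp.prems(1)])
    show "((p ^^ k) x = x) = (N dvd k)" if "x \<in> I" for x k
      using comp.prems(2)[of x k] that unfolding on_I[OF that] by simp
    show "(\<Prod>i<N. s ((p ^^ i) x)) = 1" if "x \<in> I" for x
      using comp.prems(3)[of x] that unfolding on_I[OF that] by simp
  qed
  then obtain c where c: "card I = N * c" "sign p = (-1) ^ c" "(\<Prod>x\<in>I. s x) = 1"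
    by blast
  show ?case
  \<comment> \<open>A cycle decomposition may contain empty cycles, which contribute
    nothing.\<close>
  proof (cases "cs = []")
    case True
    then show ?thesis using c by auto
  next
    case False
    have x0: "cs ! 0 \<in> set cs" using False by simp
    \<comment> \<open>Both numbers are the period of \<open>cs ! 0\<close>, so they have the same
      multiples and agree.\<close>
    have "length cs dvd k \<longleftrightarrow> N dvd k" for k
    proof -
      have "length cs dvd k \<longleftrightarrow> k mod length cs = 0"
        by (simp add: dvd_eq_mod_eq_0)
      also have "\<dots> \<longleftrightarrow> cs ! (k mod length cs) = cs ! 0"
        using False comp.hyps by (subst nth_eq_iff_index_eq) auto
      also have "\<dots> \<longleftrightarrow> N dvd k"
        using comp.prems(2)[of "cs ! 0" k] x0
        unfolding on_cs[OF x0] funpow_cycle_of_list_nth[OF comp.hyps(2) False] by simp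
      finally show ?thesis .
    qed
    then have len: "length cs = N"
      by (metis dvd_antisym dvd_refl)
    have "(\<Prod>x\<in>set cs. s x) = prod_list (map s cs)"
      using comp.hyps by (simp add: prod.distinct_set_conv_list)
    also have "\<dots> = (\<Prod>i<N. s (cs ! i))"
      using len by (simp add: prod.list_conv_set_nth lessThan_atLeast0)
    also have "\<dots> = (\<Prod>i<N. s (((?c \<circ> p) ^^ i) (cs ! 0)))"
      unfolding on_cs[OF x0] funpow_cycle_of_list_nth[OF comp.hyps(2) False]
      using len by (intro prod.cong) auto
    also have "\<dots> = 1"
      using comp.prems(3) x0 by blast
    finally have prod_cs: "(\<Prod>x\<in>set cs. s x) = 1" .
    have "odd (length cs - 1)"
      using False len \<open>even N\<close> by (cases cs) auto
    then have "sign ?c = -1"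
      using sign_cycle_of_list[of cs] comp.hyps by simp
    moreover have "permutation p"
      using p by (auto simp: permutation_permutes)
    ultimately have "sign (?c \<circ> p) = (-1) ^ Suc c"
      using c by (simp add: sign_compose permutation_of_cycle)
    moreover have "card (set cs \<union> I) = N * Suc c"
      using c p comp.hyps len by (simp add: card_Un_disjoint distinct_card)
    moreover have "(\<Prod>x\<in>set cs \<union> I. s x) = 1"
      using c p comp.hyps prod_cs by (simp add: prod.union_disjoint)
    ultimately show ?thesis by blast
  qed
qed

text \<open>If \<open>w\<close> has order dividing \<open>2 ^ Suc e\<close> and \<open>w ^^ 2 ^ e\<close> is free of fixed points,
  then all cycles of \<open>w\<close> have length exactly \<open>2 ^ Suc e\<close>.\<close>

lemma fixed_point_free_half_power:
  fixes s :: "'a \<Rightarrow> 'b::comm_monoid_mult"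
  assumes w: "w permutes S" "finite S" and "card S = 2 ^ Suc e * r" "odd r"
    and id: "\<And>x. x \<in> S \<Longrightarrow> (w ^^ 2 ^ Suc e) x = x"
    and free: "\<And>x. x \<in> S \<Longrightarrow> (w ^^ 2 ^ e) x \<noteq> x"
    and norm: "\<And>x. x \<in> S \<Longrightarrow> (\<Prod>i<2 ^ Suc e. s ((w ^^ i) x)) = 1"
  shows "sign w = -1 \<and> (\<Prod>x\<in>S. s x) = 1"
proof -
  have perm: "permutation w"
    using w by (auto simp: permutation_permutes)
  have "(w ^^ k) x = x \<longleftrightarrow> 2 ^ Suc e dvd k" if "x \<in> S" for x k
  proof -
    \<comment> \<open>\<open>least_power w x\<close> is the length of the cycle through
      \<open>x\<close>; among the divisors of \<open>2 ^ Suc e\<close> only the full power fails to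
      divide \<open>2 ^ e\<close>.\<close>
    have "least_power w x dvd 2 ^ Suc e"
      using id[OF that] by (simp add: least_power_dvd[OF perm])
    then obtain i where i: "i \<le> Suc e" "least_power w x = 2 ^ i"
      using divides_primepow_nat[OF two_is_prime_nat] by blast
    moreover have "\<not> least_power w x dvd 2 ^ e"
      using free[OF that] by (simp add: least_power_dvd[OF perm])
    ultimately have "i = Suc e"
      by (metis le_SucE le_imp_power_dvd)
    then show ?thesis
      using i by (simp add: least_power_dvd[OF perm, symmetric])
  qed
  then obtain c where c: "card S = 2 ^ Suc e * c" "sign w = (-1) ^ c" "(\<Prod>x\<in>S. s x) = 1"
    using cycle_decomp_uniform[OF cycle_decomposition[OF w], of "2 ^ Suc e" s] norm by auto
  \<comment> \<open>Cancelling \<open>2 ^ Suc e\<close> in the two formulas for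
    \<open>card S\<close> identifies the number of cycles with the odd number
    \<open>r\<close>.\<close>
  with assms have "c = r" by simp
  with c assms show ?thesis by simp
qed

text \<open>Rotates consecutive blocks of length \<open>N\<close>, and is the identity beyond
  \<open>n\<close> as \<open>permutes\<close> demands. When \<open>N > 0\<close> divides
  \<open>n\<close>, it is a model of a permutation all of whose cycles have length
  \<open>N\<close>.\<close>

definition block_rotation :: "nat \<Rightarrow> nat \<Rightarrow> nat \<Rightarrow> nat" where
  "block_rotation N n i = (if i < n then N * (i div N) + (i mod N + 1) mod N else i)"

lemma block_rotation_funpow:
  assumes "N > 0" "i < N * r"
  shows "(block_rotation N (N * r) ^^ k) i = N * (i div N) + (i mod N + k) mod N"
proof (induction k)
  case 0
  then show ?case by simp
next
  case (Suc k)
  \<comment> \<open>The iterate has to stay below \<open>N * r\<close>, where the rotation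
    acts.\<close>
  have "i div N < r"
    using assms by (simp add: less_mult_imp_div_less mult.commute)
  then have "N * Suc (i div N) \<le> N * r"
    by (intro mult_le_mono2) simp
  moreover have "(i mod N + k) mod N < N" using assms by simp
  ultimately have "N * (i div N) + (i mod N + k) mod N < N * r"
    by simp
  moreover have "Suc ((i mod N + k) mod N) mod N = (i mod N + Suc k) mod N"
    by (simp add: mod_Suc_eq)
  ultimately show ?case
    using assms(1) Suc by (simp add: block_rotation_def del: mod_add_left_eq)
qed

text \<open>The \<open>N\<close>-th iterate fixes every point below \<open>N * r\<close>, so the
  iterate of order \<open>N - 1\<close> is a left inverse there, which gives injectivity.\<close>

lemma block_rotation_permutes:
  assumes "N > 0"
  shows "block_rotation N (N * r) permutes {..<N * r}"
proof (rule inj_imp_permutes)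
  let ?w = "block_rotation N (N * r)"
  have period: "(?w ^^ N) i = i" if "i < N * r" for i
    using that assms by (simp add: block_rotation_funpow)
  show "inj_on ?w {..<N * r}"
  proof (rule inj_onI)
    fix i j assume "i \<in> {..<N * r}" "j \<in> {..<N * r}" "?w i = ?w j"
    moreover have "(?w ^^ N) x = (?w ^^ (N - 1)) (?w x)" for x
      using assms by (metis Suc_diff_1 comp_apply funpow_Suc_right)
    ultimately show "i = j"
      using period by (metis lessThan_iff)
  qed
  show "?w i \<in> {..<N * r}" if "i \<in> {..<N * r}" for i
  proof -
    have "i div N < r"
      using that by (simp add: less_mult_imp_div_less mult.commute)
    then have "N * Suc (i div N) \<le> N * r"
      by (intro mult_le_mono2) simp
    moreover have "(i mod N + 1) mod N < N" using assms by simp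
    ultimately show ?thesis
      using that by (simp add: block_rotation_def)
  qed
qed (auto simp: block_rotation_def)

subsection \<open>Finite subgroups of the multiplicative group\<close>

lemma subgroup_cmult_groupD:
  assumes "subgroup C cmult_group"
  shows "1 \<in> C" "0 \<notin> C" "x \<in> C \<Longrightarrow> y \<in> C \<Longrightarrow> x * y \<in> C" "x \<in> C \<Longrightarrow> inverse x \<in> C"
proof -
  interpret group cmult_group
    by (rule groupI) (auto simp: cmult_group_def intro!: bexI[of _ "inverse _"])
  show "1 \<in> C" "0 \<notin> C" "x \<in> C \<Longrightarrow> y \<in> C \<Longrightarrow> x * y \<in> C"
    using subgroup.one_closed[OF assms] subgroup.m_closed[OF assms] subgroup.subset[OF assms]
    by (auto simp: cmult_group_def)
  show "inverse x \<in> C" if "x \<in> C"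
  proof -
    have "x \<noteq> 0" using that \<open>0 \<notin> C\<close> by auto
    then have "inv\<^bsub>cmult_group\<^esub> x = inverse x"
      by (intro inv_equality) (auto simp: cmult_group_def)
    with subgroup.m_inv_closed[OF assms that] show ?thesis by simp
  qed
qed

text \<open>Multiplication by \<open>x\<close> permutes \<open>C\<close>, and comparing the products
  over \<open>C\<close> forces \<open>x ^ card C = 1\<close>. This equation has exactly
  \<open>card C\<close> complex roots, so they exhaust \<open>C\<close>.\<close>

lemma finite_subgroup_cmult_group_eq:
  assumes C: "subgroup C cmult_group" "finite C"
  shows "C = {z. z ^ card C = 1}"
proof (rule card_subset_eq)
  have pos: "card C > 0"
    using subgroup_cmult_groupD(1)[OF C(1)] C(2) by (auto simp: card_gt_0_iff)
  then show "finite {z::complex. z ^ card C = 1}"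
    by (intro finite_roots_unity) simp
  show "card C = card {z::complex. z ^ card C = 1}"
    using pos by (simp add: card_roots_unity_eq)
  show "C \<subseteq> {z. z ^ card C = 1}"
  proof
    fix x assume x: "x \<in> C"
    have nz: "y \<noteq> 0" if "y \<in> C" for y
      using that subgroup_cmult_groupD(2)[OF C(1)] by auto
    have "inj_on ((*) x) C"
      using nz[OF x] by (auto simp: inj_on_def)
    moreover from this have "(*) x ` C = C"
      using subgroup_cmult_groupD(3)[OF C(1) x] C(2)
      by (intro endo_inj_surj) auto
    ultimately have "(\<Prod>y\<in>C. y) = (\<Prod>y\<in>C. x * y)"
      using prod.reindex[of "(*) x" C "\<lambda>y. y"] by simp
    also have "\<dots> = x ^ card C * (\<Prod>y\<in>C. y)"
      by (simp add: prod.distrib)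
    finally show "x \<in> {z. z ^ card C = 1}"
      using nz C(2) by auto
  qed
qed

text \<open>The parities of \<open>m\<close> and \<open>m div p\<close> enter the proof through this
  criterion.\<close>

lemma minus_one_mem_iff:
  assumes "subgroup C cmult_group" "finite C"
  shows "- 1 \<in> C \<longleftrightarrow> even (card C)"
  by (subst finite_subgroup_cmult_group_eq[OF assms]) (auto simp: minus_one_power_iff)

subsection \<open>Groups of monomial matrices\<close>

text \<open>Coefficients are indexed by columns, whereas the diagonal factor of \<open>t * w\<close>
  is indexed by rows; the two differ by reindexing along \<open>w\<close>. With columns, the
  coefficients of a power are products along the orbits of \<open>w\<close>.\<close>

definition monomial_mat :: "nat \<Rightarrow> (nat \<Rightarrow> 'a::comm_ring_1) \<Rightarrow> (nat \<Rightarrow> nat) \<Rightarrow> 'a mat" where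
  "monomial_mat n s w = mat n n (\<lambda>(i, j). if i = w j then s j else 0)"

lemma monomial_mat_carrier [simp]: "monomial_mat n s w \<in> carrier_mat n n"
  by (simp add: monomial_mat_def)

lemma monomial_mat_cong:
  assumes "\<And>j. j < n \<Longrightarrow> s j = s' j" "\<And>j. j < n \<Longrightarrow> w j = w' j"
  shows "monomial_mat n s w = monomial_mat n s' w'"
  unfolding monomial_mat_def using assms by (intro cong_mat) auto

lemma monomial_mat_one: "monomial_mat n (\<lambda>_. 1) id = 1\<^sub>m n"
  by (rule eq_matI) (auto simp: monomial_mat_def)

lemma monomial_mat_smult: "c \<cdot>\<^sub>m monomial_mat n s w = monomial_mat n (\<lambda>j. c * s j) w"
  by (rule eq_matI) (auto simp: monomial_mat_def)

lemma monomial_mat_mult: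
  assumes "w' permutes {..<n}"
  shows "monomial_mat n s w * monomial_mat n s' w' = monomial_mat n (\<lambda>j. s (w' j) * s' j) (w \<circ> w')"
proof (rule eq_matI)
  fix i j assume "i < dim_row (monomial_mat n (\<lambda>j. s (w' j) * s' j) (w \<circ> w'))"
    and "j < dim_col (monomial_mat n (\<lambda>j. s (w' j) * s' j) (w \<circ> w'))"
  then have ij: "i < n" "j < n" by (auto simp: monomial_mat_def)
  have w': "w' j < n" using permutes_in_image[OF assms, of j] ij by simp
  have "(monomial_mat n s w * monomial_mat n s' w') $$ (i, j)
      = (\<Sum>k<n. (if i = w k then s k else 0) * (if k = w' j then s' j else 0))"
    using ij by (simp add: monomial_mat_def scalar_prod_def lessThan_atLeast0)
  also have "\<dots> = (\<Sum>k<n. if k = w' j then (if i = w k then s k else 0) * s' j else 0)"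
    by (intro sum.cong) auto
  also have "\<dots> = (if i = w (w' j) then s (w' j) * s' j else 0)"
    using w' by simp
  finally show "(monomial_mat n s w * monomial_mat n s' w') $$ (i, j)
      = monomial_mat n (\<lambda>j. s (w' j) * s' j) (w \<circ> w') $$ (i, j)"
    using ij by (simp add: monomial_mat_def)
qed (auto simp: monomial_mat_def)

text \<open>In the Leibniz expansion only the term of \<open>w\<close> survives: any other
  permutation meets a zero entry in some column.\<close>

lemma det_monomial_mat:
  assumes "w permutes {..<n}"
  shows "det (monomial_mat n s w) = of_int (sign w) * (\<Prod>j<n. s j)"
proof -
  have "det (monomial_mat n s w)
      = (\<Sum>p | p permutes {0..<n}. signof p * (\<Prod>j<n. monomial_mat n s w $$ (p j, j)))"
    by (rule det_col) simp
  also have "\<dots> = (\<Sum>p | p permutes {0..<n}. if p = w then of_int (sign w) * (\<Prod>j<n. s j) else 0)"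
  proof (rule sum.cong)
    fix p assume "p \<in> {p. p permutes {0..<n}}"
    then have p: "p permutes {..<n}" by (simp add: lessThan_atLeast0)
    then have *: "p j < n" if "j < n" for j
      using permutes_in_image[OF p, of j] that by simp
    show "signof p * (\<Prod>j<n. monomial_mat n s w $$ (p j, j))
        = (if p = w then of_int (sign w) * (\<Prod>j<n. s j) else 0)"
    proof (cases "p = w")
      case True
      then show ?thesis
        using * by (auto simp: monomial_mat_def sign_def intro!: prod.cong)
    next
      case False
      then obtain j where "p j \<noteq> w j" by blast
      moreover from this have "j < n"
        using p assms by (metis lessThan_iff permutes_not_in)
      ultimately have "(\<Prod>j<n. monomial_mat n s w $$ (p j, j)) = 0"
        using * by (intro prod_zero bexI[of _ j]) (auto simp: monomial_mat_def)
      then show ?thesis using False by simp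
    qed
  qed simp
  also have "\<dots> = of_int (sign w) * (\<Prod>j<n. s j)"
    using assms by (simp add: lessThan_atLeast0 finite_permutations)
  finally show ?thesis .
qed

text \<open>The nonzero entry of column \<open>j\<close> of the first matrix sits in row
  \<open>w j\<close>; the second matrix must have its entry in the same place, with the same
  value.\<close>

lemma monomial_mat_eqD:
  assumes "monomial_mat n s w = monomial_mat n s' w'"
    and "w permutes {..<n}" "w' permutes {..<n}" "\<And>j. j < n \<Longrightarrow> s j \<noteq> 0"
  shows "w = w'" "\<And>j. j < n \<Longrightarrow> s j = s' j"
proof -
  have eq: "s j = (if w j = w' j then s' j else 0)" if "j < n" for j
  proof -
    have "monomial_mat n s w $$ (w j, j) = monomial_mat n s' w' $$ (w j, j)"
      using assms(1) by simp
    then show ?thesis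
      using that permutes_in_image[OF assms(2), of j] by (simp add: monomial_mat_def)
  qed
  then have "w j = w' j" if "j < n" for j
    using assms(4)[OF that] that by (metis)
  then show "w = w'"
    using assms(2,3) by (metis ext lessThan_iff permutes_not_in)
  then show "s j = s' j" if "j < n" for j
    using eq[OF that] by simp
qed

text \<open>The exponent \<open>e\<close> selects the group: \<open>0\<close> gives \<open>G_group\<close>, \<open>1\<close> gives \<open>W_group\<close>.\<close>

definition monomial_set :: "nat \<Rightarrow> nat \<Rightarrow> complex set \<Rightarrow> complex set \<Rightarrow> complex mat set" where
  "monomial_set e n C C' = {monomial_mat n s w | s w. (\<forall>j<n. s j \<in> C) \<and> w permutes {..<n} \<and>
     of_int (sign w) ^ e * (\<Prod>j<n. s j) \<in> C'}"

lemma monomial_setI: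
  assumes "\<And>j. j < n \<Longrightarrow> s j \<in> C" "w permutes {..<n}" "of_int (sign w) ^ e * (\<Prod>j<n. s j) \<in> C'"
  shows "monomial_mat n s w \<in> monomial_set e n C C'"
  unfolding monomial_set_def using assms by blast

lemma monomial_setE:
  assumes "x \<in> monomial_set e n C C'"
  obtains s w where "x = monomial_mat n s w" "\<And>j. j < n \<Longrightarrow> s j \<in> C" "w permutes {..<n}"
    "of_int (sign w) ^ e * (\<Prod>j<n. s j) \<in> C'"
  using assms unfolding monomial_set_def by blast

section \<open>The two groups as sets of monomial matrices\<close>

lemma diag_times_perm:
  "mat_diag n f * perm_mat n w = monomial_mat n (f \<circ> w) w"
proof -
  have "perm_mat n w \<in> carrier_mat n n" by (simp add: perm_mat_def)
  then show ?thesis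
    by (subst mat_diag_mult_left) (auto simp: perm_mat_def monomial_mat_def)
qed

lemma det_mat_diag: "det (mat_diag n f) = (\<Prod>j<n. f j :: complex)"
proof -
  have "mat_diag n f = monomial_mat n f id"
    by (auto simp: mat_diag_def monomial_mat_def)
  then show ?thesis by (simp add: det_monomial_mat permutes_id)
qed

text \<open>The predicate \<open>P\<close> abstracts the determinant condition, so that both groups
  are treated at once. Passing between row and column coefficients only permutes the factors of
  their product.\<close>

lemma monomial_product_set_eq:
  assumes "\<And>f w. w permutes {..<n} \<Longrightarrow>
    P (mat_diag n f) (perm_mat n w) \<longleftrightarrow> of_int (sign w) ^ e * (\<Prod>j<n. f j) \<in> C'"
  shows "{t * w | t w. t \<in> diag_mats n C \<and> w \<in> perm_mats n \<and> P t w} = monomial_set e n C C'"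
proof (intro equalityI subsetI)
  fix x assume "x \<in> {t * w | t w. t \<in> diag_mats n C \<and> w \<in> perm_mats n \<and> P t w}"
  then obtain f w where x: "x = mat_diag n f * perm_mat n w" "\<forall>i<n. f i \<in> C"
    "w permutes {..<n}" "P (mat_diag n f) (perm_mat n w)"
    by (auto simp: diag_mats_def perm_mats_def)
  have "(\<Prod>j<n. (f \<circ> w) j) = (\<Prod>j<n. f j)"
    using prod.permute[OF x(3), of f] by (simp add: comp_def)
  then show "x \<in> monomial_set e n C C'"
    unfolding x(1) diag_times_perm
    using x(2-4) assms[OF x(3), of f] permutes_in_image[OF x(3)]
    by (intro monomial_setI) auto
next
  fix x assume "x \<in> monomial_set e n C C'"
  then obtain s w where x: "x = monomial_mat n s w" "\<And>j. j < n \<Longrightarrow> s j \<in> C" "w permutes {..<n}"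
    "of_int (sign w) ^ e * (\<Prod>j<n. s j) \<in> C'"
    by (elim monomial_setE) blast
  \<comment> \<open>Undoes the column indexing: the coefficient of column \<open>j\<close> belongs
    to row \<open>w j\<close> of the diagonal factor.\<close>
  define f where "f = s \<circ> Hilbert_Choice.inv w"
  have f: "f \<circ> w = s"
    using permutes_inv_o[OF x(3)] by (simp add: f_def comp_assoc)
  have "(\<Prod>j<n. f j) = (\<Prod>j<n. s j)"
    using prod.permute[OF x(3), of f] unfolding f .
  then have "P (mat_diag n f) (perm_mat n w)"
    using assms[OF x(3), of f] x(4) by simp
  moreover have "\<forall>i<n. f i \<in> C"
    using x(2) permutes_in_image[OF permutes_inv[OF x(3)]] by (simp add: f_def)
  moreover have "x = mat_diag n f * perm_mat n w"
    by (simp add: diag_times_perm f x(1))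
  ultimately show "x \<in> {t * w | t w. t \<in> diag_mats n C \<and> w \<in> perm_mats n \<and> P t w}"
    using x(3) by (auto simp: diag_mats_def perm_mats_def)
qed

lemma G_group_eq: "G_group n C C' = (GLn n)\<lparr>carrier := monomial_set 0 n C C'\<rparr>"
  unfolding G_group_def
  by (subst monomial_product_set_eq[where e = 0]) (auto simp: det_mat_diag)

lemma W_group_eq: "W_group n C C' = (GLn n)\<lparr>carrier := monomial_set 1 n C C'\<rparr>"
proof -
  have "det (mat_diag n f * perm_mat n w) = of_int (sign w) * (\<Prod>j<n. f j)"
    if "w permutes {..<n}" for f w
    using prod.permute[OF that, of f] that
    by (simp add: diag_times_perm det_monomial_mat comp_def)
  then show ?thesis
    unfolding W_group_def
    by (subst monomial_product_set_eq[where e = 1]) auto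
qed

lemma sign_power_compose:
  assumes "w permutes {..<n::nat}" "w' permutes {..<n}"
  shows "of_int (sign (w \<circ> w')) ^ e = (of_int (sign w) ^ e * of_int (sign w') ^ e :: complex)"
proof -
  have "permutation w" "permutation w'"
    using assms by (auto simp: permutation_permutes)
  then show ?thesis by (simp add: sign_compose power_mult_distrib)
qed

text \<open>For every \<open>e\<close>, the weight
  \<open>of_int (sign w) ^ e * (\<Prod>j<n. s j)\<close> is multiplicative in the matrix, so closure
  of \<open>C'\<close> carries over to the set.\<close>

lemma group_monomial_set:
  assumes C: "subgroup C cmult_group" and C': "subgroup C' cmult_group"
  shows "group ((GLn n)\<lparr>carrier := monomial_set e n C C'\<rparr>)" (is "group ?G")
proof (rule groupI)
  note [simp] = GLn_def units_of_def ring_mat_def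
  note D = subgroup_cmult_groupD[OF C] and D' = subgroup_cmult_groupD[OF C']
  have carr: "x \<in> carrier_mat n n" if "x \<in> monomial_set e n C C'" for x
    using that by (rule monomial_setE) simp
  show "x \<otimes>\<^bsub>?G\<^esub> y \<in> carrier ?G" if "x \<in> carrier ?G" "y \<in> carrier ?G" for x y
  proof -
    from that have "x \<in> monomial_set e n C C'" "y \<in> monomial_set e n C C'" by simp_all
    then obtain s w s' w' where
      x: "x = monomial_mat n s w" "\<And>j. j < n \<Longrightarrow> s j \<in> C" "w permutes {..<n}"
        "of_int (sign w) ^ e * (\<Prod>j<n. s j) \<in> C'" and
      y: "y = monomial_mat n s' w'" "\<And>j. j < n \<Longrightarrow> s' j \<in> C" "w' permutes {..<n}"
        "of_int (sign w') ^ e * (\<Prod>j<n. s' j) \<in> C'"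
      by (elim monomial_setE) blast
    have "(\<Prod>j<n. s (w' j) * s' j) = (\<Prod>j<n. s j) * (\<Prod>j<n. s' j)"
      using prod.permute[OF y(3), of s] by (simp add: prod.distrib comp_def)
    then have "of_int (sign (w \<circ> w')) ^ e * (\<Prod>j<n. s (w' j) * s' j)
        = (of_int (sign w) ^ e * (\<Prod>j<n. s j)) * (of_int (sign w') ^ e * (\<Prod>j<n. s' j))"
      unfolding sign_power_compose[OF x(3) y(3)] by (simp add: mult_ac)
    then have "of_int (sign (w \<circ> w')) ^ e * (\<Prod>j<n. s (w' j) * s' j) \<in> C'"
      using D'(3)[OF x(4) y(4)] by (simp only:)
    moreover have "s (w' j) * s' j \<in> C" if "j < n" for j
      using x(2) y(2) permutes_in_image[OF y(3), of j] that by (simp add: D(3))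
    ultimately have "x * y \<in> monomial_set e n C C'"
      unfolding x(1) y(1) monomial_mat_mult[OF y(3)]
      using permutes_compose[OF y(3) x(3)] by (intro monomial_setI)
    then show ?thesis by simp
  qed
  have "monomial_mat n (\<lambda>_. 1) id \<in> monomial_set e n C C'"
    using D(1) D'(1) by (intro monomial_setI permutes_id) simp_all
  then show "\<one>\<^bsub>?G\<^esub> \<in> carrier ?G"
    by (simp add: monomial_mat_one)
  show "x \<otimes>\<^bsub>?G\<^esub> y \<otimes>\<^bsub>?G\<^esub> z = x \<otimes>\<^bsub>?G\<^esub> (y \<otimes>\<^bsub>?G\<^esub> z)"
    if "x \<in> carrier ?G" "y \<in> carrier ?G" "z \<in> carrier ?G" for x y z
    using that carr[of x] carr[of y] carr[of z] by (simp add: assoc_mult_mat)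
  show "\<one>\<^bsub>?G\<^esub> \<otimes>\<^bsub>?G\<^esub> x = x" if "x \<in> carrier ?G" for x
    using that carr[of x] by simp
  show "\<exists>y\<in>carrier ?G. y \<otimes>\<^bsub>?G\<^esub> x = \<one>\<^bsub>?G\<^esub>" if "x \<in> carrier ?G" for x
  proof -
    from that have "x \<in> monomial_set e n C C'" by simp
    then obtain s w where
      x: "x = monomial_mat n s w" "\<And>j. j < n \<Longrightarrow> s j \<in> C" "w permutes {..<n}"
        "of_int (sign w) ^ e * (\<Prod>j<n. s j) \<in> C'"
      by (elim monomial_setE) blast
    \<comment> \<open>The inverse matrix carries the reciprocal of \<open>s i\<close> in column
      \<open>w i\<close>.\<close>
    let ?s = "\<lambda>j. inverse (s (Hilbert_Choice.inv w j))"
    note inv = permutes_inv[OF x(3)]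
    have nz: "s j \<noteq> 0" if "j < n" for j
      using x(2)[OF that] D(2) by metis
    have "(\<Prod>j<n. ?s j) = inverse (\<Prod>j<n. s j)"
      using prod.permute[OF inv, of "\<lambda>j. inverse (s j)"] prod_inversef[of s "{..<n}"]
      by (simp add: comp_def)
    moreover have "sign (Hilbert_Choice.inv w) = sign w"
      using x(3) by (auto intro!: sign_inverse simp: permutation_permutes)
    moreover have "inverse (of_int (sign w)) = (of_int (sign w) :: complex)"
      by (cases w rule: sign_cases) auto
    ultimately have "of_int (sign (Hilbert_Choice.inv w)) ^ e * (\<Prod>j<n. ?s j)
        = inverse (of_int (sign w) ^ e * (\<Prod>j<n. s j))"
      by (simp flip: power_inverse)
    then have "of_int (sign (Hilbert_Choice.inv w)) ^ e * (\<Prod>j<n. ?s j) \<in> C'"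
      using D'(4)[OF x(4)] by simp
    moreover have "?s j \<in> C" if "j < n" for j
      using x(2) permutes_in_image[OF inv, of j] D(4) that by simp
    ultimately have "monomial_mat n ?s (Hilbert_Choice.inv w) \<in> monomial_set e n C C'"
      using inv by (intro monomial_setI)
    moreover have "monomial_mat n ?s (Hilbert_Choice.inv w) * x = monomial_mat n (\<lambda>_. 1) id"
      unfolding x(1) monomial_mat_mult[OF x(3)]
      using nz by (intro monomial_mat_cong) (simp_all add: permutes_inverses[OF x(3)])
    ultimately show ?thesis
      by (auto simp: monomial_mat_one)
  qed
qed

subsection \<open>Counting torsion elements\<close>

text \<open>Column \<open>j\<close> of the power collects the coefficients met along the
  \<open>w\<close>-orbit of \<open>j\<close>. The carrier \<open>S\<close> is arbitrary because
  powers do not look at it, so both groups are covered.\<close>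

lemma monomial_mat_pow:
  assumes "w permutes {..<n}"
  shows "monomial_mat n s w [^]\<^bsub>(GLn n)\<lparr>carrier := S\<rparr>\<^esub> k
    = monomial_mat n (\<lambda>j. \<Prod>i<k. s ((w ^^ i) j)) (w ^^ k)"
proof (induction k)
  case 0
  then show ?case
    by (simp add: GLn_def units_of_def ring_mat_def nat_pow_def monomial_mat_one flip: id_def)
next
  case (Suc k)
  have "monomial_mat n s w [^]\<^bsub>(GLn n)\<lparr>carrier := S\<rparr>\<^esub> Suc k
      = monomial_mat n (\<lambda>j. \<Prod>i<k. s ((w ^^ i) j)) (w ^^ k) * monomial_mat n s w"
    using Suc by (simp add: nat_pow_def) (simp add: GLn_def units_of_def ring_mat_def)
  also have "\<dots> = monomial_mat n (\<lambda>j. (\<Prod>i<k. s ((w ^^ i) (w j))) * s j) (w ^^ k \<circ> w)"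
    by (rule monomial_mat_mult[OF assms])
  also have "\<dots> = monomial_mat n (\<lambda>j. \<Prod>i<Suc k. s ((w ^^ i) j)) (w ^^ Suc k)"
    by (simp only: prod.lessThan_Suc_shift funpow_Suc_right comp_apply funpow_0 mult.commute)
  finally show ?case .
qed

text \<open>Coordinates for the solutions of \<open>x ^ N = 1\<close>, with \<open>e\<close>
  selecting the group. Taking \<open>s\<close> extensional makes each matrix correspond to one pair
  only and the set finite for finite \<open>C\<close>.\<close>

definition torsion_pairs ::
    "nat \<Rightarrow> nat \<Rightarrow> nat \<Rightarrow> complex set \<Rightarrow> complex set \<Rightarrow> ((nat \<Rightarrow> complex) \<times> (nat \<Rightarrow> nat)) set" where
  "torsion_pairs e N n C C' = {(s, w). s \<in> {..<n} \<rightarrow>\<^sub>E C \<and> w permutes {..<n} \<and>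
     of_int (sign w) ^ e * (\<Prod>j<n. s j) \<in> C' \<and>
     (\<forall>j<n. (w ^^ N) j = j \<and> (\<Prod>i<N. s ((w ^^ i) j)) = 1)}"

lemma finite_torsion_pairs:
  assumes "finite C"
  shows "finite (torsion_pairs e N n C C')"
proof (rule finite_subset)
  show "torsion_pairs e N n C C' \<subseteq> ({..<n} \<rightarrow>\<^sub>E C) \<times> {w. w permutes {..<n}}"
    by (auto simp: torsion_pairs_def)
  show "finite (({..<n} \<rightarrow>\<^sub>E C) \<times> {w. w permutes {..<n}})"
    using assms by (intro finite_cartesian_product finite_PiE finite_permutations) auto
qed

lemma monomial_mat_torsion_iff:
  assumes "w permutes {..<n}"
  shows "monomial_mat n s w [^]\<^bsub>(GLn n)\<lparr>carrier := S\<rparr>\<^esub> N = \<one>\<^bsub>(GLn n)\<lparr>carrier := S\<rparr>\<^esub> \<longleftrightarrow>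
    (\<forall>j<n. (w ^^ N) j = j \<and> (\<Prod>i<N. s ((w ^^ i) j)) = (1::complex))"
    (is "?l = ?r")
proof -
  have one: "\<one>\<^bsub>(GLn n)\<lparr>carrier := S\<rparr>\<^esub> = monomial_mat n (\<lambda>_. 1) id"
    by (simp add: GLn_def units_of_def ring_mat_def monomial_mat_one)
  show ?thesis
    unfolding one monomial_mat_pow[OF assms]
  proof
    assume *: "monomial_mat n (\<lambda>j. \<Prod>i<N. s ((w ^^ i) j)) (w ^^ N) = monomial_mat n (\<lambda>_. 1) id"
    \<comment> \<open>Symmetry puts the identity matrix first, whose coefficients are visibly
      nonzero as \<open>monomial_mat_eqD\<close> requires.\<close>
    note eqD = monomial_mat_eqD[OF *[symmetric] permutes_id permutes_funpow[OF assms]]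
    show ?r
      using eqD(1) eqD(2) by (metis id_apply one_neq_zero)
  next
    assume ?r
    then show "monomial_mat n (\<lambda>j. \<Prod>i<N. s ((w ^^ i) j)) (w ^^ N) = monomial_mat n (\<lambda>_. 1) id"
      by (intro monomial_mat_cong) auto
  qed
qed

text \<open>As \<open>0 \<notin> C\<close>, a matrix determines \<open>w\<close> and the values of
  \<open>s\<close> below \<open>n\<close>; extensionality settles the remaining values.\<close>

lemma card_torsion_monomial_set:
  assumes "0 \<notin> C"
  defines "H \<equiv> \<lambda>e n C C'. (GLn n)\<lparr>carrier := monomial_set e n C C'\<rparr>"
  shows "card {x \<in> carrier (H e n C C'). x [^]\<^bsub>H e n C C'\<^esub> N = \<one>\<^bsub>H e n C C'\<^esub>}
    = card (torsion_pairs e N n C C')"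
proof -
  let ?f = "\<lambda>(s, w). monomial_mat n s w"
  have inj: "inj_on ?f (torsion_pairs e N n C C')"
  proof (rule inj_onI)
    fix a b assume ab: "a \<in> torsion_pairs e N n C C'" "b \<in> torsion_pairs e N n C C'" "?f a = ?f b"
    obtain s w s' w' where [simp]: "a = (s, w)" "b = (s', w')" by (metis surj_pair)
    have s: "s \<in> {..<n} \<rightarrow>\<^sub>E C" "s' \<in> {..<n} \<rightarrow>\<^sub>E C"
      and w: "w permutes {..<n}" "w' permutes {..<n}"
      using ab by (auto simp: torsion_pairs_def)
    have nz: "s j \<noteq> 0" if "j < n" for j
      using PiE_mem[OF s(1), of j] assms(1) that by auto
    have eq: "monomial_mat n s w = monomial_mat n s' w'" using ab(3) by simp
    have "w = w'"
      by (rule monomial_mat_eqD(1)[OF eq w nz])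
    moreover have "s = s'"
      using monomial_mat_eqD(2)[OF eq w nz] by (intro PiE_ext[OF s]) simp
    ultimately show "a = b" by simp
  qed
  have "?f ` torsion_pairs e N n C C'
      = {x \<in> carrier (H e n C C'). x [^]\<^bsub>H e n C C'\<^esub> N = \<one>\<^bsub>H e n C C'\<^esub>}"
  proof (intro equalityI subsetI)
    fix x assume "x \<in> ?f ` torsion_pairs e N n C C'"
    then obtain s w where x: "x = monomial_mat n s w" and sw: "(s, w) \<in> torsion_pairs e N n C C'"
      by auto
    then have s: "s \<in> {..<n} \<rightarrow>\<^sub>E C" and w: "w permutes {..<n}"
      and c: "of_int (sign w) ^ e * (\<Prod>j<n. s j) \<in> C'"
      and t: "\<forall>j<n. (w ^^ N) j = j \<and> (\<Prod>i<N. s ((w ^^ i) j)) = 1"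
      by (auto simp: torsion_pairs_def)
    have "x \<in> monomial_set e n C C'"
      unfolding x using PiE_mem[OF s] w c by (intro monomial_setI) auto
    then show "x \<in> {x \<in> carrier (H e n C C'). x [^]\<^bsub>H e n C C'\<^esub> N = \<one>\<^bsub>H e n C C'\<^esub>}"
      using t unfolding H_def mem_Collect_eq x monomial_mat_torsion_iff[OF w] by simp
  next
    fix x assume "x \<in> {x \<in> carrier (H e n C C'). x [^]\<^bsub>H e n C C'\<^esub> N = \<one>\<^bsub>H e n C C'\<^esub>}"
    then have "x \<in> monomial_set e n C C'" and
      tor: "x [^]\<^bsub>H e n C C'\<^esub> N = \<one>\<^bsub>H e n C C'\<^esub>"
      by (auto simp: H_def)
    then obtain s w where x: "x = monomial_mat n s w" "\<And>j. j < n \<Longrightarrow> s j \<in> C" "w permutes {..<n}"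
      "of_int (sign w) ^ e * (\<Prod>j<n. s j) \<in> C'"
      by (elim monomial_setE) blast
    define s' where "s' = restrict s {..<n}"
    have x': "x = monomial_mat n s' w"
      unfolding x(1) by (intro monomial_mat_cong) (auto simp: s'_def)
    have "s' \<in> {..<n} \<rightarrow>\<^sub>E C"
      using x(2) by (auto simp: s'_def)
    moreover have "(\<Prod>j<n. s' j) = (\<Prod>j<n. s j)"
      by (auto simp: s'_def intro: prod.cong)
    moreover have "\<forall>j<n. (w ^^ N) j = j \<and> (\<Prod>i<N. s' ((w ^^ i) j)) = 1"
      using tor unfolding x' H_def monomial_mat_torsion_iff[OF x(3)] .
    ultimately have "(s', w) \<in> torsion_pairs e N n C C'"
      using x(3,4) by (simp add: torsion_pairs_def)
    then show "x \<in> ?f ` torsion_pairs e N n C C'"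
      unfolding x' by (auto intro: rev_image_eqI)
  qed
  with card_image[OF inj] show ?thesis by metis
qed

text \<open>The orbit of \<open>i0\<close> has a length dividing \<open>H\<close>, so the second
  \<open>H\<close> steps from \<open>j\<close> visit \<open>i0\<close> as often as the first
  \<open>H\<close> steps. The new sign therefore occurs an even number of times.\<close>

lemma flip_preserves_cycle_products:
  fixes s :: "'a \<Rightarrow> 'b::comm_ring_1"
  assumes "inj w" "(w ^^ H) i0 = i0"
  shows "(\<Prod>i<2 * H. (s(i0 := - s i0)) ((w ^^ i) j)) = (\<Prod>i<2 * H. s ((w ^^ i) j))"
proof -
  define c :: "'a \<Rightarrow> 'b" where "c = (\<lambda>x. if x = i0 then -1 else 1)"
  \<comment> \<open>\<open>w ^^ H\<close> is injective and fixes \<open>i0\<close>, hence sends no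
    other point there.\<close>
  have "c ((w ^^ (i + H)) j) = c ((w ^^ i) j)" for i
  proof -
    have "inj (w ^^ H)" using assms(1) by (rule inj_fn)
    moreover have "(w ^^ (i + H)) j = (w ^^ H) ((w ^^ i) j)"
      by (metis add.commute comp_apply funpow_add)
    ultimately have "(w ^^ (i + H)) j = i0 \<longleftrightarrow> (w ^^ i) j = i0"
      using assms(2) by (metis injD)
    then show ?thesis by (simp add: c_def)
  qed
  then have "(\<Prod>i\<in>{H..<2 * H}. c ((w ^^ i) j)) = (\<Prod>i<H. c ((w ^^ i) j))"
    using prod.shift_bounds_nat_ivl[of "\<lambda>i. c ((w ^^ i) j)" 0 H H]
    by (simp add: lessThan_atLeast0 mult_2)
  moreover have "{..<2 * H} = {..<H} \<union> {H..<2 * H}" by auto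
  ultimately have "(\<Prod>i<2 * H. c ((w ^^ i) j)) = (\<Prod>i<H. c ((w ^^ i) j)) * (\<Prod>i<H. c ((w ^^ i) j))"
    by (simp add: prod.union_disjoint ivl_disj_int)
  also have "\<dots> = (\<Prod>i<H. c ((w ^^ i) j) * c ((w ^^ i) j))"
    by (simp add: prod.distrib)
  also have "\<dots> = 1"
    by (intro prod.neutral) (auto simp: c_def)
  finally have "(\<Prod>i<2 * H. c ((w ^^ i) j)) = 1" .
  moreover have "(s(i0 := - s i0)) x = c x * s x" for x
    by (simp add: c_def)
  ultimately show ?thesis
    by (simp add: prod.distrib del: fun_upd_apply)
qed

lemma prod_flip:
  fixes s :: "nat \<Rightarrow> 'b::comm_ring_1"
  assumes "i0 < n"
  shows "(\<Prod>j<n. (s(i0 := - s i0)) j) = - (\<Prod>j<n. s j)"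
proof -
  have "(\<Prod>j<n. (s(i0 := - s i0)) j) = - s i0 * (\<Prod>j\<in>{..<n} - {i0}. s j)"
    using assms by (subst prod.remove[of _ i0]) (auto intro!: arg_cong2[where f = "(*)"] prod.cong)
  also have "\<dots> = - (\<Prod>j<n. s j)"
    using assms by (subst (2) prod.remove[of _ i0]) auto
  finally show ?thesis .
qed

text \<open>A sign flip at a point fixed by \<open>w ^^ 2 ^ e\<close> negates the determinant of \<open>(s, w)\<close> but keeps
  the torsion condition, so it moves the odd \<open>w\<close> of the second group into the first one. Elements
  over a \<open>w\<close> without such a point exist for odd \<open>w\<close> in the first group only.\<close>

lemma card_torsion_pairs_less:
  assumes C: "finite C" "1 \<in> C" "\<And>x. x \<in> C \<Longrightarrow> - x \<in> C"
    and C': "1 \<in> C'" "- 1 \<notin> C'"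
    and n: "n = 2 ^ Suc e * r" "odd r"
  shows "card (torsion_pairs 1 (2 ^ Suc e) n C C') < card (torsion_pairs 0 (2 ^ Suc e) n C C')"
proof -
  let ?T = "\<lambda>k. torsion_pairs k (2 ^ Suc e) n C C'"
  define P where "P w i \<longleftrightarrow> i < n \<and> (w ^^ 2 ^ e) i = i" for w i
  \<comment> \<open>The point depends on \<open>w\<close> alone, and \<open>f\<close> keeps
    \<open>w\<close>, so the flip can be undone; this makes \<open>f\<close> injective.\<close>
  define p where "p w = (SOME i. P w i)" for w
  define f where "f = (\<lambda>(s :: nat \<Rightarrow> complex, w :: nat \<Rightarrow> nat).
    if sign w = 1 then (s, w) else (s(p w := - s (p w)), w))"
  have free: "sign w = -1 \<and> (\<Prod>j<n. s j) = 1"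
    if "(s, w) \<in> ?T k" "\<nexists>i. P w i" for s w k
    using that n fixed_point_free_half_power[of w "{..<n}" e r s]
    by (auto simp: torsion_pairs_def P_def)
  have p: "p w < n" "(w ^^ 2 ^ e) (p w) = p w" if "(s, w) \<in> ?T 1" "sign w \<noteq> 1" for s w
  proof -
    \<comment> \<open>Otherwise \<open>free\<close> would give sign -1 and product 1, so the weight
      -1 would lie in \<open>C'\<close>.\<close>
    have "\<exists>i. P w i"
      using free[OF that(1)] that C'(2) by (force simp: torsion_pairs_def)
    then have "P w (p w)" unfolding p_def by (rule someI_ex)
    then show "p w < n" "(w ^^ 2 ^ e) (p w) = p w" by (auto simp: P_def)
  qed
  have inj: "inj_on f (?T 1)"
  proof (rule inj_onI)
    fix a b assume eq: "f a = f b"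
    obtain s w s' w' where [simp]: "a = (s, w)" "b = (s', w')" by (metis surj_pair)
    have flip: "s = s'" if "s(i := - s i) = s'(i := - s' i)" for i
    proof
      fix x
      show "s x = s' x"
        using fun_cong[OF that, of x] by (cases "x = i") auto
    qed
    have "w = w'"
      using eq by (simp add: f_def split: if_splits)
    then show "a = b"
      using eq flip[of "p w"] by (auto simp: f_def simp del: fun_upd_apply split: if_splits)
  qed
  have img: "f ` ?T 1 \<subseteq> ?T 0"
  proof (rule image_subsetI)
    fix a assume a: "a \<in> ?T 1"
    obtain s w where [simp]: "a = (s, w)" by fastforce
    show "f a \<in> ?T 0"
    proof (cases "sign w = 1")
      case True
      then show ?thesis using a by (simp add: f_def torsion_pairs_def)
    next
      case False
      have sgn: "sign w = -1" using False by (cases w rule: sign_cases) auto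
      have w: "w permutes {..<n}" and s: "s \<in> {..<n} \<rightarrow>\<^sub>E C"
        using a by (auto simp: torsion_pairs_def)
      have pw: "p w < n" "(w ^^ 2 ^ e) (p w) = p w"
        using p a False by auto
      have "s(p w := - s (p w)) \<in> {..<n} \<rightarrow>\<^sub>E C"
        using s pw(1) C(3) by (auto simp: PiE_iff extensional_def)
      \<comment> \<open>For odd \<open>w\<close> the weight in the second group is minus the product
        of \<open>s\<close>, which is the plain product after the flip.\<close>
      then show ?thesis
        using a False sgn w flip_preserves_cycle_products[OF permutes_inj[OF w] pw(2), of s]
        by (simp add: f_def torsion_pairs_def prod_flip[OF pw(1)] del: fun_upd_apply)
    qed
  qed
  \<comment> \<open>This pair witnesses strictness: all cycles of \<open>w0\<close> have full
    length, so no flip leads to it.\<close>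
  define w0 where "w0 = block_rotation (2 ^ Suc e) n"
  define s0 :: "nat \<Rightarrow> complex" where "s0 = restrict (\<lambda>_. 1) {..<n}"
  have w0: "w0 permutes {..<n}"
    unfolding w0_def n(1) by (rule block_rotation_permutes) simp
  have funpow_w0: "(w0 ^^ k) i = 2 ^ Suc e * (i div 2 ^ Suc e) + (i mod 2 ^ Suc e + k) mod 2 ^ Suc e"
    if "i < n" for i k
    using block_rotation_funpow[of "2 ^ Suc e" i r k] that n by (simp add: w0_def)
  have mem: "(s0, w0) \<in> ?T 0"
  proof -
    have "(w0 ^^ i) j < n" if "j < n" for i j
      using permutes_in_image[OF permutes_funpow[OF w0], of i j] that by simp
    then have "\<forall>j<n. (w0 ^^ 2 ^ Suc e) j = j \<and> (\<Prod>i<2 ^ Suc e. s0 ((w0 ^^ i) j)) = 1"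
      by (auto simp: funpow_w0 s0_def intro!: prod.neutral simp del: power_Suc)
    moreover have "s0 \<in> {..<n} \<rightarrow>\<^sub>E C"
      using C(2) by (auto simp: s0_def)
    moreover have "(\<Prod>j<n. s0 j) = 1"
      by (simp add: s0_def)
    ultimately show ?thesis
      using w0 C'(1) unfolding torsion_pairs_def by simp
  qed
  have no_fix: "\<nexists>i. P w0 i"
  proof
    assume "\<exists>i. P w0 i"
    then obtain i where i: "i < n" "(w0 ^^ 2 ^ e) i = i" by (auto simp: P_def)
    \<comment> \<open>Moving by \<open>2 ^ e\<close> goes half way round a block, so it cannot
      return to the start.\<close>
    then have "(i mod 2 ^ Suc e + 2 ^ e) mod 2 ^ Suc e = i mod 2 ^ Suc e"
      using funpow_w0[OF i(1), of "2 ^ e"]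
      by (metis add_left_cancel mult_div_mod_eq)
    then have "(i + 2 ^ e) mod 2 ^ Suc e = i mod 2 ^ Suc e"
      by (simp only: mod_add_left_eq)
    then have "(2::nat) ^ Suc e dvd 2 ^ e"
      by (subst (asm) mod_eq_dvd_iff_nat) simp_all
    then show False
      by (auto dest: power_dvd_imp_le)
  qed
  have "(s0, w0) \<notin> f ` ?T 1"
  proof
    assume "(s0, w0) \<in> f ` ?T 1"
    \<comment> \<open>Since \<open>f\<close> keeps the permutation, a preimage would also lie over
      \<open>w0\<close>, and \<open>free\<close> would put -1 into \<open>C'\<close>.\<close>
    then obtain s where s: "(s, w0) \<in> ?T 1"
      by (auto simp: f_def split: if_splits)
    from free[OF s no_fix] s C'(2) show False
      by (simp add: torsion_pairs_def)
  qed
  then have "f ` ?T 1 \<subset> ?T 0"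
    using img mem by blast
  then have "card (f ` ?T 1) < card (?T 0)"
    by (intro psubset_card_mono finite_torsion_pairs C(1))
  then show ?thesis
    unfolding card_image[OF inj] .
qed

text \<open>An isomorphism commutes with powers and only the identity goes to the identity. This
  count is the invariant that separates the two groups.\<close>

lemma is_iso_card_torsion_eq:
  assumes "G \<cong> H" "group G" "group H"
  shows "card {x \<in> carrier G. x [^]\<^bsub>G\<^esub> (N::nat) = \<one>\<^bsub>G\<^esub>} = card {x \<in> carrier H. x [^]\<^bsub>H\<^esub> N = \<one>\<^bsub>H\<^esub>}"
proof -
  obtain h where h: "h \<in> hom G H" "bij_betw h (carrier G) (carrier H)"
    using assms(1) by (auto simp: is_iso_def iso_def)
  interpret G: group G by fact
  interpret H: group H by fact
  have "h (x [^]\<^bsub>G\<^esub> N) = \<one>\<^bsub>H\<^esub> \<longleftrightarrow> x [^]\<^bsub>G\<^esub> N = \<one>\<^bsub>G\<^esub>" if "x \<in> carrier G" for x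
    using hom_one[OF h(1) assms(2,3)] h(2) that
    by (metis G.nat_pow_closed G.one_closed bij_betw_imp_inj_on inj_onD)
  then have iff: "h x [^]\<^bsub>H\<^esub> N = \<one>\<^bsub>H\<^esub> \<longleftrightarrow> x [^]\<^bsub>G\<^esub> N = \<one>\<^bsub>G\<^esub>" if "x \<in> carrier G" for x
    using hom_nat_pow[OF h(1) that assms(2,3)] that by metis
  have img: "h ` {x \<in> carrier G. x [^]\<^bsub>G\<^esub> N = \<one>\<^bsub>G\<^esub>} = {x \<in> carrier H. x [^]\<^bsub>H\<^esub> N = \<one>\<^bsub>H\<^esub>}"
    unfolding bij_betw_imp_surj_on[OF h(2), symmetric] using iff by blast
  have inj: "inj_on h {x \<in> carrier G. x [^]\<^bsub>G\<^esub> N = \<one>\<^bsub>G\<^esub>}"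
    using bij_betw_imp_inj_on[OF h(2)] by (rule inj_on_subset) auto
  show ?thesis
    using card_image[OF inj] unfolding img by (rule sym)
qed

subsection \<open>The two isomorphic cases\<close>

text \<open>The quotient recovers the sign of the permutation underlying a monomial matrix: its column
  sums are its nonzero entries.\<close>

definition monomial_sign :: "nat \<Rightarrow> complex mat \<Rightarrow> complex" where
  "monomial_sign n x = det x / (\<Prod>j<n. \<Sum>i<n. x $$ (i, j))"

lemma monomial_sign_eq:
  assumes "w permutes {..<n}" "\<And>j. j < n \<Longrightarrow> s j \<noteq> 0"
  shows "monomial_sign n (monomial_mat n s w) = of_int (sign w)"
proof -
  have "(\<Sum>i<n. monomial_mat n s w $$ (i, j)) = s j" if "j < n" for j
    using that permutes_in_image[OF assms(1), of j] by (simp add: monomial_mat_def)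
  then have "(\<Prod>j<n. \<Sum>i<n. monomial_mat n s w $$ (i, j)) = (\<Prod>j<n. s j)"
    by (intro prod.cong) auto
  moreover have "(\<Prod>j<n. s j) \<noteq> 0"
    using assms(2) by simp
  ultimately show ?thesis
    by (simp add: monomial_sign_def det_monomial_mat[OF assms(1)])
qed

text \<open>Scaling by the sign multiplies the product of the coefficients by
  \<open>sign w ^ n\<close>, which is \<open>sign w\<close> for odd \<open>n\<close>; this exchanges
  the two weights. Scalars commute with matrices and the sign is multiplicative, so the map is a
  homomorphism, and \<open>- 1 \<in> C\<close> keeps the entries in \<open>C\<close>.\<close>

lemma monomial_set_iso_of_odd:
  assumes C: "subgroup C cmult_group" "- 1 \<in> C" and C': "subgroup C' cmult_group" and "odd n"
  shows "(GLn n)\<lparr>carrier := monomial_set 0 n C C'\<rparr> \<cong> (GLn n)\<lparr>carrier := monomial_set 1 n C C'\<rparr>"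
    (is "?G \<cong> ?W")
proof -
  note [simp] = GLn_def units_of_def ring_mat_def
  note D = subgroup_cmult_groupD[OF C(1)]
  define h where "h = (\<lambda>x. monomial_sign n x \<cdot>\<^sub>m x)"
  have h: "h (monomial_mat n s w) = monomial_mat n (\<lambda>j. of_int (sign w) * s j) w"
    if "w permutes {..<n}" and s: "\<forall>j<n. s j \<in> C" for s w
  proof -
    have "s j \<noteq> 0" if "j < n" for j
      using D(2) s that by metis
    then show ?thesis
      by (simp add: h_def monomial_sign_eq[OF that(1)] monomial_mat_smult)
  qed
  have sgn_mem: "of_int (sign w) * z \<in> C" if "z \<in> C" for w :: "nat \<Rightarrow> nat" and z
    using D(3)[OF C(2) that] that by (cases w rule: sign_cases) auto
  have sgn_pow: "of_int (sign w) ^ n = (of_int (sign w) :: complex)" for w :: "nat \<Rightarrow> nat"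
    using \<open>odd n\<close> by (cases w rule: sign_cases) auto
  have sgn_sq: "of_int (sign w) * (of_int (sign w) * z) = (z :: complex)" for w :: "nat \<Rightarrow> nat" and z
    by (cases w rule: sign_cases) auto
  \<comment> \<open>Both directions at once: \<open>1 - k\<close> names the other group.\<close>
  have mem: "h x \<in> monomial_set (1 - k) n C C'" if "x \<in> monomial_set k n C C'" "k \<le> 1" for x k
  proof -
    from that(1) obtain s w where x: "x = monomial_mat n s w" "\<forall>j<n. s j \<in> C"
      "w permutes {..<n}" "of_int (sign w) ^ k * (\<Prod>j<n. s j) \<in> C'"
      by (elim monomial_setE) blast
    have eq: "of_int (sign w) ^ (1 - k) * (\<Prod>j<n. of_int (sign w) * s j)
        = of_int (sign w) ^ k * (\<Prod>j<n. s j)"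
      using that(2) by (cases k) (auto simp: prod.distrib sgn_pow sgn_sq)
    show ?thesis
      unfolding x(1) h[OF x(3,2)] by (intro monomial_setI sgn_mem x(3)) (use eq x(2,4) in simp_all)
  qed
  have inv: "h (h x) = x" if "x \<in> monomial_set k n C C'" for x k
  proof -
    from that obtain s w where x: "x = monomial_mat n s w" "\<forall>j<n. s j \<in> C"
      "w permutes {..<n}"
      by (elim monomial_setE) blast
    from x(2) have "\<forall>j<n. of_int (sign w) * s j \<in> C"
      using sgn_mem by simp
    from h[OF x(3) this] show ?thesis
      unfolding x(1) h[OF x(3,2)]
      by (simp add: sgn_sq)
  qed
  have "h (x * y) = h x * h y" if "x \<in> monomial_set 0 n C C'" "y \<in> monomial_set 0 n C C'" for x y
  proof -
    from that(1) obtain s w where x: "x = monomial_mat n s w" "\<forall>j<n. s j \<in> C"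
      "w permutes {..<n}" by (elim monomial_setE) blast
    from that(2) obtain s' w' where y: "y = monomial_mat n s' w'" "\<forall>j<n. s' j \<in> C"
      "w' permutes {..<n}" by (elim monomial_setE) blast
    have "\<forall>j<n. s (w' j) * s' j \<in> C"
      using x(2) y(2) permutes_in_image[OF y(3)] by (simp add: D(3))
    from h[OF permutes_compose[OF y(3) x(3)] this]
    show ?thesis
      unfolding x(1) y(1) h[OF x(3,2)] h[OF y(3,2)] monomial_mat_mult[OF y(3)]
      using sign_power_compose[OF x(3) y(3), of 1]
      by (simp del: o_apply) (intro monomial_mat_cong, simp_all)
  qed
  then have "h \<in> hom ?G ?W"
    using mem[of _ 0] by (auto simp: hom_def)
  moreover have "bij_betw h (monomial_set 0 n C C') (monomial_set 1 n C C')"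
    \<comment> \<open>Scaling leaves the permutation alone and signs square to 1, so
      \<open>h\<close> is its own inverse.\<close>
    using mem[of _ 0] mem[of _ 1] inv by (intro bij_betw_byWitness[where f' = h]) auto
  ultimately show ?thesis
    by (auto simp: is_iso_def iso_def)
qed

text \<open>The two weights differ at most by a sign, which membership in \<open>C'\<close> does not
  detect.\<close>

lemma monomial_set_eq_of_minus_one:
  assumes "subgroup C' cmult_group" "- 1 \<in> C'"
  shows "monomial_set e n C C' = monomial_set e' n C C'"
proof -
  note D = subgroup_cmult_groupD[OF assms(1)]
  have "of_int (sign w) ^ k * z \<in> C' \<longleftrightarrow> z \<in> C'" for w :: "nat \<Rightarrow> nat" and z k
  proof -
    have "- z \<in> C' \<longleftrightarrow> z \<in> C'" for z
      using D(3)[OF assms(2), of z] D(3)[OF assms(2), of "- z"] by auto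
    then show ?thesis
      by (cases w rule: sign_cases) (auto simp: minus_one_power_iff)
  qed
  then show ?thesis by (simp add: monomial_set_def)
qed

section \<open>The isomorphism criterion\<close>

theorem theorem2p9:
  fixes n m p :: nat and C C' :: "complex set"
  assumes "n \<ge> 1" and "m \<ge> 2" and "even m" and "p dvd m"
    and "subgroup C cmult_group" and "finite C" and "card C = m"
    and "subgroup C' cmult_group" and "finite C'" and "card C' = m div p"
  shows "\<not> (G_group n C C' \<cong> W_group n C C') \<longleftrightarrow> even n \<and> odd (m div p)"
proof -
  let ?H = "\<lambda>k. (GLn n)\<lparr>carrier := monomial_set k n C C'\<rparr>"
  note C = subgroup_cmult_groupD[OF assms(5)] and C' = subgroup_cmult_groupD[OF assms(8)]
  have minus_C: "- 1 \<in> C"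
    using minus_one_mem_iff[OF assms(5,6)] assms(3,7) by simp
  have minus_C': "- 1 \<in> C' \<longleftrightarrow> even (m div p)"
    using minus_one_mem_iff[OF assms(8,9)] assms(10) by simp
  have grp: "group (?H k)" for k
    by (rule group_monomial_set[OF assms(5,8)])
  show ?thesis
    unfolding G_group_eq W_group_eq
  proof
    assume not_iso: "\<not> (?H 0 \<cong> ?H 1)"
    have "odd (m div p)"
      using not_iso monomial_set_eq_of_minus_one[OF assms(8), of 0 n C 1] minus_C' iso_refl
      by metis
    moreover have "even n"
      using not_iso monomial_set_iso_of_odd[OF assms(5) minus_C assms(8)] by blast
    ultimately show "even n \<and> odd (m div p)" by simp
  next
    assume *: "even n \<and> odd (m div p)"
    have "n \<noteq> 0" "\<not> is_unit (2 :: nat)" using assms(1) by auto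
    then obtain e' r where n: "n = 2 ^ e' * r" "odd r"
      by (rule multiplicity_decompose') blast
    \<comment> \<open>Evenness of \<open>n\<close> makes the exponent of 2 positive, so that the
      half power \<open>2 ^ e\<close> used in the count exists.\<close>
    with * obtain e where e: "e' = Suc e" by (cases e') auto
    have "card (torsion_pairs 1 (2 ^ Suc e) n C C') < card (torsion_pairs 0 (2 ^ Suc e) n C C')"
    proof (rule card_torsion_pairs_less)
      show "- x \<in> C" if "x \<in> C" for x
        using C(3)[OF minus_C that] by simp
      show "n = 2 ^ Suc e * r" using n(1) unfolding e .
    qed (use * minus_C' in \<open>simp_all only: C(1) C'(1) n(2) assms(6) simp_thms\<close>)
    moreover have "card (torsion_pairs 0 (2 ^ Suc e) n C C') = card (torsion_pairs 1 (2 ^ Suc e) n C C')"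
      if "?H 0 \<cong> ?H 1"
      using is_iso_card_torsion_eq[OF that grp grp, of "2 ^ Suc e"]
      unfolding card_torsion_monomial_set[OF C(2)] .
    ultimately show "\<not> (?H 0 \<cong> ?H 1)"
      by (metis less_irrefl)
  qed
qed

end
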